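(* Let $F$ be a real Hilbert space whose elements are equivalence classes of functions $D\to\mathbb{R}$ (for instance $F=L_2(D)$), let $G$ be a real Hilbert space, and let $S:F\to G$ be a compact linear operator. Then for all $n\in\mathbb{N}=\{1,2,\dots\}$, $$e_n^{\rm std\text{-}wor}(S)\ge e_n^{\rm all\text{-}wor}(S),$$ where $e_n^{\rm std\text{-}wor}(S)$ is defined with respect to the space $\widetilde V_{n+k}$ of everywhere defined functions described in the context, for any $k\ge1$ and any choice of representatives $\tilde e_i\in e_i$, $i=1,\dots,n+k$.
   Context: Minimal errors for continuous linear functionals. Let $\Lambda^{\rm all}$ be the class of all continuous linear functionals $F\to\mathbb{R}$. For an integer $n\ge0$, an algorithm $A_n:F\to G$ using $n$ functionals from $\Lambda^{\rm all}$ is a mapping $A_n(f)=\phi_n(y_1,\dots,y_n)$ with $y_j=L_j(f;y_1,\dots,y_{j-1})$, where $\phi_n:\mathbb{R}^n\to G$ is arbitrary and $L_j(\cdot\,;y_1,\dots,y_{j-1})\in\Lambda^{\rm all}$ for all $j$ and all $y_1,\dots,y_{j-1}\in\mathbb{R}$ (adaptive choice allowed). Its error is $e(A_n)=\sup_{\|f\|_F<1}\|S(f)-A_n(f)\|_G$, and $e_n^{\rm all\text{-}wor}(S)$ is the infimum of $e(A_n)$ over all such algorithms. The space $\widetilde V_{n+k}$. Let $\sigma_1\ge\sigma_2\ge\dots\ge0$ be the singular values of $S$ (with multiplicity, $\lim_i\sigma_i=0$) and $(e_i)$ a corresponding orthonormal system in $F$, so that $S^*Sf=\sum_i\sigma_i^2\langle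 f,e_i\rangle e_i$ for all $f\in F$ and $S(e_i)=\sigma_ie_i'$ with orthonormal $e_i'$ in $G$ (for $\sigma_i>0$). For each $i=1,\dots,n+k$ choose a function $\tilde e_i:D\to\mathbb{R}$ in the equivalence class $e_i$, and let $\widetilde V_{n+k}={\rm span}(\tilde e_1,\dots,\tilde e_{n+k})$; this is a space of functions defined everywhere on $D$. (If $\dim F<n+k$, use all available $e_i$, which then span $F$.) Each $\tilde f=\sum_i\alpha_i\tilde e_i\in\widetilde V_{n+k}$ represents the element $f=\sum_i\alpha_ie_i\in F$; put $\|\tilde f\|=\|f\|_F$ and $S(\tilde f)=S(f)$. Minimal errors for function values. $e_n^{\rm std\text{-}wor}(S)$ is the infimum, over all algorithms $A_n:\widetilde V_{n+k}\to G$ using at most $n$ (possibly adaptively chosen) function values $\tilde f\mapsto\tilde f(x)$, $x\in D$, i.e. mappings $A_n(\tilde f)=\phi_n(y_1,\dots,y_n)$ with $y_j=\tilde f(x_j)$, where $\phi_n:\mathbb{R}^n\to G$ is arbitrary and each point $x_j=x_j(y_1,\dots,y_{j-1})\in D$ may depend on the already computed values $y_1,\dots,y_{j-1}$, of the worst case error $$\sup_{\tilde f\in\widetilde V_{n+k},\ \|\tilde f\|<1}\|S(\tilde f)-A_n(\tilde f)\|_G.$$ *)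

theory Defs
  imports "HOL-Analysis.Analysis"
begin

(* The Hilbert space F is the type 'f, and cls f is the equivalence class of functions on D (the
   type 'd) that f stands for.  The classes form a quotient X // R of a set X of functions, and the
   vector space operations of F are those induced by the pointwise operations. *)
definition function_class_space :: "('f::real_vector \<Rightarrow> ('d \<Rightarrow> real) set) \<Rightarrow> bool" where
  "function_class_space cls \<longleftrightarrow>
     (\<exists>X R. equiv X R \<and> bij_betw cls UNIV (X // R)) \<and>
     (\<forall>f g. \<forall>u\<in>cls f. \<forall>v\<in>cls g. (\<lambda>x. u x + v x) \<in> cls (f + g)) \<and>
     (\<forall>c f. \<forall>u\<in>cls f. (\<lambda>x. c * u x) \<in> cls (c *\<^sub>R f))"

definition compact_operator :: "('f::real_normed_vector \<Rightarrow> 'g::real_normed_vector) \<Rightarrow> bool" where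
  "compact_operator S \<longleftrightarrow> linear S \<and> (\<forall>B. bounded B \<longrightarrow> compact (closure (S ` B)))"

definition orthonormal_family :: "nat set \<Rightarrow> (nat \<Rightarrow> 'a::real_inner) \<Rightarrow> bool" where
  "orthonormal_family I e \<longleftrightarrow> (\<forall>i\<in>I. \<forall>j\<in>I. e i \<bullet> e j = (if i = j then 1 else 0))"

(* I is the index set of the available e i: {1..} if F is infinite dimensional, and {1..d} if F has
   finite dimension d.  An orthonormal family indexed by {1..} excludes finite dimension, and
   spanning by {1..d} forces dimension d.  The sequence of singular values is always infinite; it
   is padded with zeros in the finite-dimensional case.  The values sigma 0, e 0 are irrelevant. *)
definition singular_system ::
  "('f::real_inner \<Rightarrow> 'g::real_inner) \<Rightarrow> nat set \<Rightarrow> (nat \<Rightarrow> real) \<Rightarrow> (nat \<Rightarrow> 'f) \<Rightarrow> bool" where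
  "singular_system S I \<sigma> e \<longleftrightarrow>
     (I = {1..} \<or> (\<exists>d. I = {1..d} \<and> span (e ` I) = UNIV)) \<and>
     orthonormal_family I e \<and>
     (\<forall>i\<ge>1. 0 \<le> \<sigma> i \<and> \<sigma> (Suc i) \<le> \<sigma> i) \<and> (\<forall>i\<ge>1. i \<notin> I \<longrightarrow> \<sigma> i = 0) \<and> \<sigma> \<longlonglongrightarrow> 0 \<and>
     (\<forall>f. ((\<lambda>i. ((\<sigma> i)\<^sup>2 * (f \<bullet> e i)) *\<^sub>R e i) has_sum adjoint S (S f)) I) \<and>
     (\<exists>e'. orthonormal_family {i\<in>I. \<sigma> i > 0} e' \<and> (\<forall>i\<in>I. \<sigma> i > 0 \<longrightarrow> S (e i) = \<sigma> i *\<^sub>R e' i))"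

(* The list [y_1, ..., y_n] of adaptively computed values y_j = L [y_1, ..., y_(j-1)] f. *)
primrec adaptive_info :: "(real list \<Rightarrow> 'x \<Rightarrow> real) \<Rightarrow> nat \<Rightarrow> 'x \<Rightarrow> real list" where
  "adaptive_info L 0 f = []"
| "adaptive_info L (Suc j) f = adaptive_info L j f @ [L (adaptive_info L j f) f]"

definition algorithms_all :: "nat \<Rightarrow> ('f::real_normed_vector \<Rightarrow> 'g) set" where
  "algorithms_all n = {(\<lambda>f. \<phi> (adaptive_info L n f)) | \<phi> L. \<forall>ys. bounded_linear (L ys)}"

definition error_all :: "('f::real_normed_vector \<Rightarrow> 'g::real_normed_vector) \<Rightarrow> ('f \<Rightarrow> 'g) \<Rightarrow> ennreal" where
  "error_all S A = (SUP f\<in>{f. norm f < 1}. ennreal (norm (S f - A f)))"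

definition e_all_wor :: "nat \<Rightarrow> ('f::real_normed_vector \<Rightarrow> 'g::real_normed_vector) \<Rightarrow> ennreal" where
  "e_all_wor n S = (INF A\<in>algorithms_all n. error_all S A)"

definition V_tilde :: "(nat \<Rightarrow> 'd \<Rightarrow> real) \<Rightarrow> nat set \<Rightarrow> ('d \<Rightarrow> real) set" where
  "V_tilde et J = {(\<lambda>x. \<Sum>i\<in>J. \<alpha> i * et i x) | \<alpha>. True}"

(* The function u in V_tilde et J represents the element f of F.  If every et i lies in the class
   of e i, then f is determined by u (lemma represents_unique), so the norm and the solution
   attached to u are norm f and S f. *)
definition represents ::
  "(nat \<Rightarrow> 'f::real_vector) \<Rightarrow> (nat \<Rightarrow> 'd \<Rightarrow> real) \<Rightarrow> nat set \<Rightarrow> ('d \<Rightarrow> real) \<Rightarrow> 'f \<Rightarrow> bool" where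
  "represents e et J u f \<longleftrightarrow>
     (\<exists>\<alpha>. u = (\<lambda>x. \<Sum>i\<in>J. \<alpha> i * et i x) \<and> f = (\<Sum>i\<in>J. \<alpha> i *\<^sub>R e i))"

lemma function_class_sum:
  assumes "function_class_space cls" "finite J" "\<forall>i\<in>J. et i \<in> cls (e i)"
  shows "(\<lambda>x. \<Sum>i\<in>J. \<alpha> i * et i x) \<in> cls (\<Sum>i\<in>J. \<alpha> i *\<^sub>R e i)"
  using assms(2,3)
proof (induction J rule: finite_induct)
  case empty
  obtain X R where XR: "equiv X R" "bij_betw cls UNIV (X // R)"
    using assms(1) by (auto simp: function_class_space_def)
  then have "cls 0 \<in> X // R" by (auto simp: bij_betw_def)
  then obtain v where "v \<in> cls 0" using in_quotient_imp_non_empty[OF XR(1)] by blast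
  then have "(\<lambda>x. 0 * v x) \<in> cls (0 *\<^sub>R 0)"
    using assms(1) unfolding function_class_space_def by blast
  then show ?case by simp
next
  case (insert j J)
  have "(\<lambda>x. \<alpha> j * et j x) \<in> cls (\<alpha> j *\<^sub>R e j)"
    using assms(1) insert.prems unfolding function_class_space_def by blast
  moreover have "(\<lambda>x. \<Sum>i\<in>J. \<alpha> i * et i x) \<in> cls (\<Sum>i\<in>J. \<alpha> i *\<^sub>R e i)"
    using insert by blast
  ultimately have "(\<lambda>x. \<alpha> j * et j x + (\<Sum>i\<in>J. \<alpha> i * et i x)) \<in> cls (\<alpha> j *\<^sub>R e j + (\<Sum>i\<in>J. \<alpha> i *\<^sub>R e i))"
    using assms(1) by (simp add: function_class_space_def)
  then show ?case using insert.hyps by simp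
qed

lemma represents_unique:
  assumes "function_class_space cls" "finite J" "\<forall>i\<in>J. et i \<in> cls (e i)"
    and "represents e et J u f" "represents e et J u g"
  shows "f = g"
proof -
  obtain X R where XR: "equiv X R" "bij_betw cls UNIV (X // R)"
    using assms(1) by (auto simp: function_class_space_def)
  have "u \<in> cls f" "u \<in> cls g"
    using assms(4,5) function_class_sum[OF assms(1-3)] by (auto simp: represents_def)
  moreover have "cls f \<in> X // R" "cls g \<in> X // R" using XR(2) by (auto simp: bij_betw_def)
  ultimately have "cls f = cls g" using quotient_disj[OF XR(1)] by blast
  then show ?thesis using XR(2) by (auto simp: bij_betw_def dest: injD)
qed

definition algorithms_std :: "nat \<Rightarrow> (('d \<Rightarrow> real) \<Rightarrow> 'g) set" where
  "algorithms_std n =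
     {(\<lambda>u. \<phi> (adaptive_info (\<lambda>ys u. u (pt ys)) n u)) | \<phi> (pt :: real list \<Rightarrow> 'd). True}"

definition error_std :: "('f::real_normed_vector \<Rightarrow> 'g::real_normed_vector) \<Rightarrow> (nat \<Rightarrow> 'f) \<Rightarrow>
    (nat \<Rightarrow> 'd \<Rightarrow> real) \<Rightarrow> nat set \<Rightarrow> (('d \<Rightarrow> real) \<Rightarrow> 'g) \<Rightarrow> ennreal" where
  "error_std S e et J A =
     (SUP (u, f)\<in>{(u, f). u \<in> V_tilde et J \<and> represents e et J u f \<and> norm f < 1}.
        ennreal (norm (S f - A u)))"

definition e_std_wor :: "nat \<Rightarrow> ('f::real_normed_vector \<Rightarrow> 'g::real_normed_vector) \<Rightarrow> (nat \<Rightarrow> 'f) \<Rightarrow>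
    (nat \<Rightarrow> 'd \<Rightarrow> real) \<Rightarrow> nat set \<Rightarrow> ennreal" where
  "e_std_wor n S e et J = (INF A\<in>algorithms_std n. error_std S e et J A)"

end

theory Submission
  imports Defs
begin

text \<open>Both minimal errors are compared with \<open>\<sigma> (n + 1)\<close>. Truncating the singular value decomposition
  after \<open>n\<close> terms uses \<open>n\<close> linear functionals and has error at most \<open>\<sigma> (n + 1)\<close>. Conversely, \<open>n\<close>
  function values cannot distinguish \<open>u\<close>, \<open>- u\<close> and \<open>0\<close> for some nonzero \<open>u\<close> in the span of the first
  \<open>n + 1\<close> representatives, since the points chosen when all values vanish impose only \<open>n\<close> homogeneous
  equations on \<open>n + 1\<close> coefficients; and \<open>S\<close> stretches this span by at least \<open>\<sigma> (n + 1)\<close>.\<close>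

text \<open>Riesz representation: \<open>z\<close> minimizes \<open>x \<bullet> x - 2 * \<phi> x\<close>. The parallelogram law makes minimizing
  sequences Cauchy. Needed because \<^const>\<open>adjoint\<close> is a choice operator that the library treats only on
  Euclidean spaces.\<close>
lemma bounded_linear_eq_inner:
  fixes \<phi> :: "'a::{real_inner, complete_space} \<Rightarrow> real"
  assumes "bounded_linear \<phi>"
  shows "\<exists>z. \<forall>x. \<phi> x = x \<bullet> z"
proof -
  interpret bounded_linear \<phi> by fact
  define J where "J x = x \<bullet> x - 2 * \<phi> x" for x
  obtain B where B: "\<bar>\<phi> x\<bar> \<le> norm x * B" for x using bounded by auto
  \<comment> \<open>Completing the square in \<open>norm x\<close> gives the constant:
    \<open>J x\<close> is at least \<open>(norm x - B)\<^sup>2 - B\<^sup>2\<close>.\<close>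
  have lower: "- (B\<^sup>2) \<le> J x" for x
  proof -
    have "\<phi> x \<le> norm x * B" using B[of x] by linarith
    moreover have "0 \<le> (norm x - B)\<^sup>2" by simp
    ultimately show ?thesis
      by (simp add: J_def power2_diff dot_square_norm)
  qed
  define m where "m = Inf (range J)"
  have bdd: "bdd_below (range J)" using lower by (auto intro!: bdd_belowI)
  have m_le: "m \<le> J x" for x unfolding m_def by (rule cInf_lower[OF _ bdd]) simp
  have "\<exists>x. J x < m + inverse (real (Suc k))" for k
    using cInf_lessD[of "range J" "m + inverse (real (Suc k))"] by (auto simp: m_def)
  then obtain X where X: "J (X k) < m + inverse (real (Suc k))" for k by metis
  have midpoint: "(dist x y)\<^sup>2 \<le> 2 * J x + 2 * J y - 4 * m" for x y
  proof -
    define c where "c = (1/2) *\<^sub>R (x + y)"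
    have "(dist x y)\<^sup>2 = 2 * J x + 2 * J y - 4 * J c"
      by (simp add: c_def J_def dist_norm power2_norm_eq_inner inner_diff inner_add scaleR add
          inner_commute algebra_simps)
    then show ?thesis using m_le[of c] by linarith
  qed
  have "Cauchy X"
  proof (rule metric_CauchyI)
    fix r :: real assume "r > 0"
    \<comment> \<open>A quarter of \<open>r\<^sup>2\<close> suffices because \<open>midpoint\<close>
      counts the excess over \<open>m\<close> twice for each of the two points.\<close>
    then obtain N where N: "inverse (real (Suc N)) < r\<^sup>2 / 4"
      using reals_Archimedean[of "r\<^sup>2 / 4"] by auto
    have close: "J (X k) - m < r\<^sup>2 / 4" if "k \<ge> N" for k
    proof -
      have "inverse (real (Suc k)) \<le> inverse (real (Suc N))"
        using that by (intro le_imp_inverse_le) auto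
      then show ?thesis using X[of k] N by linarith
    qed
    have "dist (X i) (X j) < r" if "i \<ge> N" "j \<ge> N" for i j
    proof -
      have "(dist (X i) (X j))\<^sup>2 < r\<^sup>2"
        using midpoint[of "X i" "X j"] close[OF that(1)] close[OF that(2)] by linarith
      then show ?thesis using \<open>r > 0\<close> by (simp add: power2_less_imp_less)
    qed
    then show "\<exists>M. \<forall>i\<ge>M. \<forall>j\<ge>M. dist (X i) (X j) < r" by blast
  qed
  then obtain z where z: "X \<longlonglongrightarrow> z" by (auto simp: Cauchy_convergent_iff convergent_def)
  have "(\<lambda>k. J (X k)) \<longlonglongrightarrow> J z"
    unfolding J_def by (intro tendsto_intros tendsto z)
  moreover have "(\<lambda>k. m + inverse (real (Suc k))) \<longlonglongrightarrow> m + 0"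
    by (intro tendsto_intros LIMSEQ_inverse_real_of_nat)
  ultimately have "J z \<le> m + 0"
    using X by (intro LIMSEQ_le) (auto intro: less_imp_le)
  then have min: "J z \<le> J x" for x using m_le[of x] by linarith
  have "\<phi> x = x \<bullet> z" for x
  proof (cases "x = 0")
    case True
    then show ?thesis by (simp add: zero)
  next
    case False
    define d where "d = \<phi> x - x \<bullet> z"
    \<comment> \<open>This \<open>t\<close> minimizes the quadratic
      \<open>J (z + t *\<^sub>R x)\<close> in \<open>t\<close>; the value changes by
      \<open>- t * d\<close>, so minimality of \<open>z\<close> forces \<open>d = 0\<close>.\<close>
    define t where "t = d / (x \<bullet> x)"
    have "J (z + t *\<^sub>R x) = J z + t * (t * (x \<bullet> x)) - 2 * t * d"
      by (simp add: J_def d_def add scaleR inner_add inner_commute algebra_simps)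
    also have "t * (x \<bullet> x) = d" using False by (simp add: t_def)
    finally have "t * d \<le> 0" using min[of "z + t *\<^sub>R x"] by linarith
    moreover have "0 < x \<bullet> x" using False by simp
    ultimately have "d * d \<le> 0" by (simp add: t_def divide_le_0_iff)
    then have "d = 0" by (metis mult_eq_0_iff order_antisym zero_le_square)
    then show ?thesis by (simp add: d_def)
  qed
  then show ?thesis by blast
qed

section \<open>Adjoint and boundedness of the operator\<close>

text \<open>Riesz representation for each fixed \<open>y\<close> yields some map with the adjoint
  property, so the choice behind \<open>adjoint\<close> selects such a map.\<close>

lemma inner_adjoint:
  fixes S :: "'f::{real_inner, complete_space} \<Rightarrow> 'g::real_inner"
  assumes "bounded_linear S"
  shows "S x \<bullet> y = x \<bullet> adjoint S y"
proof -
  have "\<exists>z. \<forall>x. S x \<bullet> y = x \<bullet> z" for y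
    using bounded_linear_compose[OF bounded_linear_inner_left assms]
    by (rule bounded_linear_eq_inner)
  then have "\<exists>T. \<forall>x y. S x \<bullet> y = x \<bullet> T y" by metis
  then have "\<forall>x y. S x \<bullet> y = x \<bullet> adjoint S y"
    unfolding adjoint_def by (rule someI_ex)
  then show ?thesis by blast
qed

text \<open>The image of the closed unit ball is relatively compact, hence bounded; homogeneity
  extends the bound to all vectors.\<close>

lemma compact_operator_bounded_linear:
  assumes "compact_operator S"
  shows "bounded_linear S"
proof -
  interpret linear S using assms by (simp add: compact_operator_def)
  have "compact (closure (S ` cball 0 1))"
    using assms bounded_cball by (simp add: compact_operator_def)
  then have "bounded (S ` cball 0 1)"
    by (rule bounded_subset[OF compact_imp_bounded closure_subset])
  then obtain B where B: "\<And>x. norm x \<le> 1 \<Longrightarrow> norm (S x) \<le> B"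
    by (fastforce simp: bounded_iff)
  have "norm (S x) \<le> norm x * B" for x
  proof (cases "x = 0")
    case True
    then show ?thesis by (simp add: zero)
  next
    case False
    have "norm (S ((1 / norm x) *\<^sub>R x)) \<le> B" by (rule B) simp
    then show ?thesis using False by (simp add: scaleR field_simps)
  qed
  then show ?thesis by (intro bounded_linear_intro[of S B]) (simp_all add: add scaleR)
qed

section \<open>Finite orthonormal sums and homogeneous linear systems\<close>

text \<open>Pythagoras: the projection \<open>p\<close> satisfies
  \<open>f \<bullet> p = p \<bullet> p\<close>.\<close>

lemma norm_residual_orthonormal:
  assumes "finite J" "orthonormal_family J e"
  shows "(norm (f - (\<Sum>i\<in>J. (f \<bullet> e i) *\<^sub>R e i)))\<^sup>2 = (norm f)\<^sup>2 - (\<Sum>i\<in>J. (f \<bullet> e i)\<^sup>2)"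
proof -
  define p where "p = (\<Sum>i\<in>J. (f \<bullet> e i) *\<^sub>R e i)"
  have fp: "f \<bullet> p = (\<Sum>i\<in>J. (f \<bullet> e i)\<^sup>2)"
    by (simp add: p_def inner_sum_right power2_eq_square)
  have "p \<bullet> e j = f \<bullet> e j" if "j \<in> J" for j
  proof -
    have "p \<bullet> e j = (\<Sum>i\<in>J. if i = j then f \<bullet> e i else 0)"
      unfolding p_def inner_sum_left
      by (rule sum.cong) (use assms(2) that in \<open>auto simp: orthonormal_family_def\<close>)
    then show ?thesis using that assms(1) by simp
  qed
  then have "p \<bullet> p = (\<Sum>i\<in>J. (f \<bullet> e i)\<^sup>2)"
    by (subst (2) p_def) (simp add: inner_sum_right power2_eq_square)
  then show ?thesis using fp
    by (simp flip: p_def add: power2_norm_eq_inner inner_diff inner_commute)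
qed

lemma inner_orthonormal_sum:
  assumes "finite J" "J \<subseteq> I" "orthonormal_family I e" "j \<in> I"
  shows "(\<Sum>i\<in>J. \<alpha> i *\<^sub>R e i) \<bullet> e j = (if j \<in> J then \<alpha> j else 0)"
proof -
  have "(\<Sum>i\<in>J. \<alpha> i *\<^sub>R e i) \<bullet> e j = (\<Sum>i\<in>J. if i = j then \<alpha> i else 0)"
    unfolding inner_sum_left
    by (rule sum.cong) (use assms in \<open>auto simp: orthonormal_family_def\<close>)
  then show ?thesis using assms(1) by simp
qed

lemma bessel_inequality:
  assumes "finite J" "orthonormal_family J e"
  shows "(\<Sum>i\<in>J. (f \<bullet> e i)\<^sup>2) \<le> (norm f)\<^sup>2"
  using norm_residual_orthonormal[OF assms, of f] by (metis diff_ge_0_iff_ge zero_le_power2)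

text \<open>Gaussian elimination: each equation with a nonzero coefficient is used to remove one
  unknown, so unknowns remain when the equations run out.\<close>

lemma underdetermined_system:
  fixes a :: "'i \<Rightarrow> 'k \<Rightarrow> real"
  assumes "finite K" "finite J" "card K < card J"
  shows "\<exists>\<alpha>. (\<exists>i\<in>J. \<alpha> i \<noteq> 0) \<and> (\<forall>k\<in>K. (\<Sum>i\<in>J. \<alpha> i * a i k) = 0)"
  using assms
proof (induction K arbitrary: J a rule: finite_induct)
  case empty
  then obtain j where "j \<in> J" by fastforce
  then show ?case by (intro exI[of _ "\<lambda>_. 1"]) auto
next
  case (insert k K)
  show ?case
  proof (cases "\<forall>i\<in>J. a i k = 0")
    case True
    obtain \<alpha> where "\<exists>i\<in>J. \<alpha> i \<noteq> 0" "\<forall>k\<in>K. (\<Sum>i\<in>J. \<alpha> i * a i k) = 0"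
      using insert.IH[of J a] insert.prems insert.hyps by auto
    with True show ?thesis by auto
  next
    case False
    then obtain j where j: "j \<in> J" "a j k \<noteq> 0" by blast
    \<comment> \<open>Row \<open>m\<close> after eliminating the unknown \<open>j\<close> with pivot
      \<open>a j k\<close>.\<close>
    define b where "b i m = a i m - a i k / a j k * a j m" for i m
    have "card K < card (J - {j})" using insert.prems insert.hyps j by simp
    then obtain \<alpha> where \<alpha>: "\<exists>i\<in>J - {j}. \<alpha> i \<noteq> 0" "\<forall>m\<in>K. (\<Sum>i\<in>J - {j}. \<alpha> i * b i m) = 0"
      using insert.IH[of "J - {j}" b] insert.prems by auto
    \<comment> \<open>Back substitution: the value \<open>- c\<close> for the unknown
      \<open>j\<close> is the one that solves equation \<open>k\<close>.\<close>
    define c where "c = (\<Sum>i\<in>J - {j}. \<alpha> i * a i k) / a j k"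
    define \<beta> where "\<beta> = \<alpha>(j := - c)"
    have split: "(\<Sum>i\<in>J. \<beta> i * a i m) = (\<Sum>i\<in>J - {j}. \<alpha> i * a i m) - c * a j m" for m
    proof -
      have "(\<Sum>i\<in>J. \<beta> i * a i m) = \<beta> j * a j m + (\<Sum>i\<in>J - {j}. \<beta> i * a i m)"
        using insert.prems j by (simp add: sum.remove)
      also have "(\<Sum>i\<in>J - {j}. \<beta> i * a i m) = (\<Sum>i\<in>J - {j}. \<alpha> i * a i m)"
        by (rule sum.cong) (auto simp: \<beta>_def)
      finally show ?thesis by (simp add: \<beta>_def)
    qed
    have "(\<Sum>i\<in>J. \<beta> i * a i m) = 0" if "m \<in> K" for m
    proof -
      have "(\<Sum>i\<in>J - {j}. \<alpha> i * b i m) = (\<Sum>i\<in>J - {j}. \<alpha> i * a i m) - c * a j m"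
        by (simp add: b_def c_def algebra_simps sum_subtractf sum_distrib_left sum_divide_distrib)
      then show ?thesis using \<alpha>(2) that split by simp
    qed
    moreover have "(\<Sum>i\<in>J. \<beta> i * a i k) = 0" using j by (simp add: split c_def)
    moreover have "\<exists>i\<in>J. \<beta> i \<noteq> 0" using \<alpha>(1) by (auto simp: \<beta>_def)
    ultimately show ?thesis by (intro exI[of _ \<beta>]) auto
  qed
qed

section \<open>Singular values as bounds for the operator\<close>

lemma singular_system_mono:
  assumes "singular_system S I \<sigma> e" "1 \<le> i" "i \<le> j"
  shows "\<sigma> j \<le> \<sigma> i"
  using assms(3)
proof (induction j rule: dec_induct)
  case (step j)
  have "\<sigma> (Suc j) \<le> \<sigma> j"
    using assms(1,2) step.hyps unfolding singular_system_def by auto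
  with step.IH show ?case by linarith
qed simp

text \<open>Pairing the expansion of \<open>adjoint S (S f)\<close> with \<open>f\<close>, by
  continuity of the inner product, turns it into a series for
  \<open>S f \<bullet> S f\<close>.\<close>

lemma singular_system_norm_has_sum:
  fixes S :: "'f::{real_inner, complete_space} \<Rightarrow> 'g::real_inner"
  assumes "bounded_linear S" "singular_system S I \<sigma> e"
  shows "((\<lambda>i. (\<sigma> i)\<^sup>2 * (f \<bullet> e i)\<^sup>2) has_sum (norm (S f))\<^sup>2) I"
proof -
  have "((\<lambda>i. ((\<sigma> i)\<^sup>2 * (f \<bullet> e i)) *\<^sub>R e i) has_sum adjoint S (S f)) I"
    using assms(2) by (simp add: singular_system_def)
  then have "((\<lambda>i. f \<bullet> ((\<sigma> i)\<^sup>2 * (f \<bullet> e i)) *\<^sub>R e i) has_sum (f \<bullet> adjoint S (S f))) I"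
    by (rule has_sum_bounded_linear[OF bounded_linear_inner_right])
  moreover have "f \<bullet> adjoint S (S f) = (norm (S f))\<^sup>2"
    by (simp flip: inner_adjoint[OF assms(1)] add: power2_norm_eq_inner)
  ultimately show ?thesis by (simp add: power2_eq_square mult.assoc)
qed

text \<open>Only terms beyond \<open>n\<close> survive in the series for the squared norm; their
  factors are at most \<open>(\<sigma> (Suc n))\<^sup>2\<close>, and Bessel bounds the rest.\<close>

lemma singular_system_norm_le:
  fixes S :: "'f::{real_inner, complete_space} \<Rightarrow> 'g::real_inner"
  assumes "bounded_linear S" "singular_system S I \<sigma> e"
    and "\<And>i. i \<in> I \<Longrightarrow> i \<le> n \<Longrightarrow> f \<bullet> e i = 0"
  shows "norm (S f) \<le> \<sigma> (Suc n) * norm f"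
proof -
  have pos: "\<sigma> (Suc n) \<ge> 0" and ort: "orthonormal_family I e"
    and nonneg: "\<And>i. i \<in> I \<Longrightarrow> 0 \<le> \<sigma> i"
    using assms(2) by (auto simp: singular_system_def)
  have "(norm (S f))\<^sup>2 \<le> (\<sigma> (Suc n) * norm f)\<^sup>2"
  proof (rule has_sum_le_finite_sums[OF singular_system_norm_has_sum[OF assms(1,2)]])
    fix M assume M: "finite M" "M \<subseteq> I"
    have "(\<sigma> i)\<^sup>2 * (f \<bullet> e i)\<^sup>2 \<le> (\<sigma> (Suc n))\<^sup>2 * (f \<bullet> e i)\<^sup>2" if "i \<in> M" for i
    proof (cases "i \<le> n")
      case True
      then show ?thesis using assms(3) that M by auto
    next
      case False
      then have "\<sigma> i \<le> \<sigma> (Suc n)"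
        using singular_system_mono[OF assms(2), of "Suc n" i] by simp
      then show ?thesis using nonneg that M by (intro mult_right_mono power_mono) auto
    qed
    then have "(\<Sum>i\<in>M. (\<sigma> i)\<^sup>2 * (f \<bullet> e i)\<^sup>2) \<le> (\<sigma> (Suc n))\<^sup>2 * (\<Sum>i\<in>M. (f \<bullet> e i)\<^sup>2)"
      by (simp add: sum_distrib_left sum_mono)
    also have "\<dots> \<le> (\<sigma> (Suc n))\<^sup>2 * (norm f)\<^sup>2"
    proof -
      have "orthonormal_family M e" using ort M by (simp add: orthonormal_family_def subset_iff)
      then show ?thesis using M by (intro mult_left_mono bessel_inequality) auto
    qed
    finally show "(\<Sum>i\<in>M. (\<sigma> i)\<^sup>2 * (f \<bullet> e i)\<^sup>2) \<le> (\<sigma> (Suc n) * norm f)\<^sup>2"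
      by (simp add: power_mult_distrib)
  qed
  then show ?thesis by (rule power2_le_imp_le) (simp add: pos)
qed

text \<open>On a finite span the squared norm is the sum of squared coefficients. Each is weighted
  by at least \<open>(\<sigma> m)\<^sup>2\<close> in the series for \<open>S f\<close>, whose other
  terms are nonnegative.\<close>

lemma singular_system_norm_ge:
  fixes S :: "'f::{real_inner, complete_space} \<Rightarrow> 'g::real_inner"
  assumes "bounded_linear S" "singular_system S I \<sigma> e"
    and J: "finite J" "J \<subseteq> I" "\<And>i. i \<in> J \<Longrightarrow> i \<le> m" and "m \<ge> 1"
    and f: "f = (\<Sum>i\<in>J. \<alpha> i *\<^sub>R e i)"
  shows "\<sigma> m * norm f \<le> norm (S f)"
proof -
  have pos: "\<sigma> m \<ge> 0" and ort: "orthonormal_family I e" and I1: "\<And>i. i \<in> I \<Longrightarrow> 1 \<le> i"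
    using assms(2) \<open>m \<ge> 1\<close> by (auto simp: singular_system_def)
  have coeff: "f \<bullet> e i = \<alpha> i" if "i \<in> J" for i
    using inner_orthonormal_sum[OF J(1,2) ort, of i \<alpha>] that J(2) by (auto simp: f)
  have "(norm f)\<^sup>2 = (\<Sum>i\<in>J. (f \<bullet> e i)\<^sup>2)"
    unfolding power2_norm_eq_inner
    by (subst (2) f) (simp add: inner_sum_right coeff power2_eq_square)
  then have "(\<sigma> m * norm f)\<^sup>2 = (\<Sum>i\<in>J. (\<sigma> m)\<^sup>2 * (f \<bullet> e i)\<^sup>2)"
    by (simp add: power_mult_distrib sum_distrib_left)
  also have "\<dots> \<le> (\<Sum>i\<in>J. (\<sigma> i)\<^sup>2 * (f \<bullet> e i)\<^sup>2)"
    using singular_system_mono[OF assms(2) I1] J pos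
    by (intro sum_mono mult_right_mono power_mono) auto
  also have "\<dots> \<le> (norm (S f))\<^sup>2"
    by (rule finite_sum_le_has_sum[OF singular_system_norm_has_sum[OF assms(1,2)]])
      (use J in auto)
  finally show ?thesis by (rule power2_le_imp_le) simp
qed

section \<open>Information and the two bounds on minimal errors\<close>

lemma adaptive_info_nonadaptive:
  "adaptive_info (\<lambda>ys. L (length ys)) n f = map (\<lambda>j. L j f) [0..<n]"
  by (induction n) auto

text \<open>Along constant answers an adaptive method visits a fixed sequence of queries, so only
  those need checking.\<close>

lemma adaptive_info_eq_replicate:
  assumes "\<And>j. j < n \<Longrightarrow> L (replicate j c) f = c"
  shows "adaptive_info L n f = replicate n c"
  using assms by (induction n) (auto simp: replicate_append_same)

lemma e_all_wor_le:
  fixes S :: "'f::{real_inner, complete_space} \<Rightarrow> 'g::real_inner"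
  assumes "bounded_linear S" "singular_system S I \<sigma> e"
  shows "e_all_wor n S \<le> ennreal (\<sigma> (Suc n))"
proof -
  interpret bounded_linear S by fact
  have pos: "\<sigma> (Suc n) \<ge> 0" and ort: "orthonormal_family I e" and I1: "\<And>i. i \<in> I \<Longrightarrow> 1 \<le> i"
    using assms(2) by (auto simp: singular_system_def)
  define J where "J = I \<inter> {1..n}"
  have J: "finite J" "J \<subseteq> I" "orthonormal_family J e"
    using ort by (auto simp: J_def orthonormal_family_def)
  \<comment> \<open>The list length is the number of values already computed, so the next functional
    is the coefficient with index one larger. Indices outside \<open>I\<close> may occur, but
    \<open>\<phi>\<close> reads only positions from \<open>J\<close>.\<close>
  define L :: "real list \<Rightarrow> 'f \<Rightarrow> real" where "L ys f = f \<bullet> e (Suc (length ys))" for ys f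
  define \<phi> where "\<phi> ys = (\<Sum>i\<in>J. (ys ! (i - 1)) *\<^sub>R S (e i))" for ys :: "real list"
  define A where "A f = \<phi> (adaptive_info L n f)" for f
  have "bounded_linear (L ys)" for ys
    unfolding L_def by (rule bounded_linear_inner_left)
  then have "A \<in> algorithms_all n" unfolding algorithms_all_def A_def by blast
  moreover have "error_all S A \<le> ennreal (\<sigma> (Suc n))"
    unfolding error_all_def
  proof (rule SUP_least)
    fix f :: 'f assume "f \<in> {f. norm f < 1}"
    then have nf: "norm f < 1" by simp
    define r where "r = f - (\<Sum>i\<in>J. (f \<bullet> e i) *\<^sub>R e i)"
    have "adaptive_info L n f = map (\<lambda>j. f \<bullet> e (Suc j)) [0..<n]"
      using adaptive_info_nonadaptive[of "\<lambda>j f. f \<bullet> e (Suc j)" n f] by (simp add: L_def[abs_def])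
    then have "A f = (\<Sum>i\<in>J. (f \<bullet> e i) *\<^sub>R S (e i))"
      unfolding A_def \<phi>_def by (intro sum.cong) (auto simp: J_def)
    then have Sr: "S f - A f = S r" by (simp add: r_def diff sum scaleR)
    have "r \<bullet> e i = 0" if "i \<in> I" "i \<le> n" for i
      using that I1[of i] inner_orthonormal_sum[OF J(1,2) ort, of i "\<lambda>i. f \<bullet> e i"]
      by (simp add: r_def inner_diff_left J_def)
    then have "norm (S r) \<le> \<sigma> (Suc n) * norm r"
      by (rule singular_system_norm_le[OF assms])
    moreover have "(norm r)\<^sup>2 \<le> (norm f)\<^sup>2"
      unfolding r_def norm_residual_orthonormal[OF J(1,3)] by (simp add: sum_nonneg)
    then have "norm r \<le> norm f" by (rule power2_le_imp_le) simp
    then have "norm r \<le> 1" using nf by linarith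
    then have "\<sigma> (Suc n) * norm r \<le> \<sigma> (Suc n)" using pos by (simp add: mult_left_le)
    ultimately have "norm (S r) \<le> \<sigma> (Suc n)" by linarith
    then show "ennreal (norm (S f - A f)) \<le> ennreal (\<sigma> (Suc n))"
      by (simp add: Sr ennreal_leI)
  qed
  ultimately show ?thesis unfolding e_all_wor_def by (rule INF_lower2[where f = "error_all S"])
qed

lemma e_std_wor_ge:
  fixes S :: "'f::{real_inner, complete_space} \<Rightarrow> 'g::real_inner"
  assumes "bounded_linear S" "singular_system S I \<sigma> e" "k \<ge> 1"
  shows "ennreal (\<sigma> (Suc n)) \<le> e_std_wor n S e et (I \<inter> {1..n + k})"
proof (cases "Suc n \<in> I")
  case False
  then have "\<sigma> (Suc n) = 0" using assms(2) by (simp add: singular_system_def)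
  then show ?thesis by simp
next
  case True
  interpret bounded_linear S by fact
  have ort: "orthonormal_family I e" and pos: "\<sigma> (Suc n) \<ge> 0"
    using assms(2) by (auto simp: singular_system_def)
  have sub: "{1..Suc n} \<subseteq> I" using True assms(2) by (auto simp: singular_system_def)
  define J where "J = I \<inter> {1..n + k}"
  \<comment> \<open>Here \<open>k \<ge> 1\<close> provides the representative with index
    \<open>n + 1\<close>.\<close>
  have J: "finite J" "{1..Suc n} \<subseteq> J" using sub assms(3) by (auto simp: J_def)
  have "ennreal (\<sigma> (Suc n)) \<le> error_std S e et J A" if A: "A \<in> algorithms_std n" for A
  proof -
    obtain \<phi> pt where A_eq: "A = (\<lambda>u. \<phi> (adaptive_info (\<lambda>ys u. u (pt ys)) n u))"
      using A by (auto simp: algorithms_std_def)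
    \<comment> \<open>The points \<open>pt (replicate j 0)\<close> are those chosen when all earlier
      answers are zero; they depend on the method alone, which makes the conditions linear in
      \<alpha>.\<close>
    obtain \<alpha> where \<alpha>: "\<exists>i\<in>{1..Suc n}. \<alpha> i \<noteq> 0"
      "\<forall>j\<in>{..<n}. (\<Sum>i\<in>{1..Suc n}. \<alpha> i * et i (pt (replicate j 0))) = 0"
      using underdetermined_system[of "{..<n}" "{1..Suc n}" "\<lambda>i j. et i (pt (replicate j 0))"]
      by auto
    define g where "g = (\<Sum>i\<in>{1..Suc n}. \<alpha> i *\<^sub>R e i)"
    have "g \<noteq> 0"
    proof
      assume "g = 0"
      then have "\<alpha> i = 0" if "i \<in> {1..Suc n}" for i
        using inner_orthonormal_sum[of "{1..Suc n}" I e i \<alpha>] sub ort that by (auto simp: g_def)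
      then show False using \<alpha>(1) by blast
    qed
    define u where "u c x = (\<Sum>i\<in>{1..Suc n}. (c * \<alpha> i) * et i x)" for c x
    have rep: "u c \<in> V_tilde et J \<and> represents e et J (u c) (c *\<^sub>R g)" for c
    proof -
      \<comment> \<open>Extension by zero from the first \<open>n + 1\<close> indices to all of
        \<open>J\<close>.\<close>
      define \<beta> where "\<beta> i = (if i \<in> {1..Suc n} then c * \<alpha> i else 0)" for i
      have "u c = (\<lambda>x. \<Sum>i\<in>J. \<beta> i * et i x)"
      proof
        fix x
        show "u c x = (\<Sum>i\<in>J. \<beta> i * et i x)" unfolding u_def
          by (rule sum.mono_neutral_cong_left) (use J in \<open>auto simp: \<beta>_def\<close>)
      qed
      moreover have "c *\<^sub>R g = (\<Sum>i\<in>J. \<beta> i *\<^sub>R e i)" unfolding g_def scaleR_sum_right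
        by (rule sum.mono_neutral_cong_left) (use J in \<open>auto simp: \<beta>_def\<close>)
      ultimately show ?thesis unfolding V_tilde_def represents_def by blast
    qed
    have "u c (pt (replicate j 0)) = 0" if "j < n" for c j
      using \<alpha>(2) that by (simp add: u_def mult.assoc flip: sum_distrib_left)
    then have A_u: "A (u c) = \<phi> (replicate n 0)" for c
      unfolding A_eq by (subst adaptive_info_eq_replicate[where c = 0]) auto
    have err: "ennreal (norm (c *\<^sub>R S g - \<phi> (replicate n 0))) \<le> error_std S e et J A"
      if "norm (c *\<^sub>R g) < 1" for c
    proof -
      have "ennreal (norm (S (c *\<^sub>R g) - A (u c))) \<le> error_std S e et J A"
        unfolding error_std_def
        by (rule SUP_upper2[where i = "(u c, c *\<^sub>R g)"]) (use rep that in auto)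
      then show ?thesis by (simp add: scaleR A_u)
    qed
    \<comment> \<open>The open unit ball excludes \<open>t = 1\<close>; that value is reached by a
      limit at the end.\<close>
    have scaled: "ennreal (t * \<sigma> (Suc n)) \<le> error_std S e et J A" if t: "0 < t" "t < 1" for t
    proof -
      define c where "c = t / norm g"
      have c: "c > 0" "c * norm g = t" using \<open>g \<noteq> 0\<close> t by (auto simp: c_def)
      let ?a = "c *\<^sub>R S g" and ?y = "\<phi> (replicate n 0)"
      have "\<sigma> (Suc n) * norm g \<le> norm (S g)"
        by (rule singular_system_norm_ge[OF assms(1,2) _ sub]) (auto simp: g_def)
      then have "c * (\<sigma> (Suc n) * norm g) \<le> c * norm (S g)"
        using c(1) by (intro mult_left_mono) auto
      then have ge: "t * \<sigma> (Suc n) \<le> norm ?a"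
        using c by (simp add: algebra_simps flip: c(2))
      \<comment> \<open>The method returns the same \<open>?y\<close> for both signs of
        \<open>c\<close>, and the two solutions lie \<open>2 * norm ?a\<close> apart, so one of the
        two errors is at least \<open>norm ?a\<close>.\<close>
      have "2 * norm ?a = norm ((?a - ?y) - ((- c) *\<^sub>R S g - ?y))"
        by (simp flip: scaleR_2 add: abs_mult)
      also have "\<dots> \<le> norm (?a - ?y) + norm ((- c) *\<^sub>R S g - ?y)"
        by (rule norm_triangle_ineq4)
      finally have "t * \<sigma> (Suc n) \<le> norm (?a - ?y) \<or> t * \<sigma> (Suc n) \<le> norm ((- c) *\<^sub>R S g - ?y)"
        using ge by linarith
      then show ?thesis
        using err[of c] err[of "- c"] c t by (auto intro: order_trans[OF ennreal_leI])
    qed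
    \<comment> \<open>The double \<open>Suc\<close> starts the scaling factors at one half, as
      \<open>scaled\<close> requires \<open>t > 0\<close>.\<close>
    have "(\<lambda>m. ennreal ((1 - inverse (real (Suc (Suc m)))) * \<sigma> (Suc n)))
            \<longlonglongrightarrow> ennreal ((1 - 0) * \<sigma> (Suc n))"
      by (intro tendsto_intros LIMSEQ_Suc[OF LIMSEQ_inverse_real_of_nat])
    moreover have "ennreal ((1 - inverse (real (Suc (Suc m)))) * \<sigma> (Suc n)) \<le> error_std S e et J A" for m
      by (rule scaled) (auto simp: field_simps)
    ultimately show ?thesis by (auto intro: LIMSEQ_le_const2)
  qed
  then show ?thesis unfolding e_std_wor_def J_def[symmetric] by (rule INF_greatest)
qed

theorem corollary1:
  fixes S :: "'f::{real_inner, complete_space} \<Rightarrow> 'g::{real_inner, complete_space}"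
    and cls :: "'f \<Rightarrow> ('d \<Rightarrow> real) set"
    and I :: "nat set" and \<sigma> :: "nat \<Rightarrow> real" and e :: "nat \<Rightarrow> 'f"
    and et :: "nat \<Rightarrow> 'd \<Rightarrow> real"
    and n k :: nat
  assumes "function_class_space cls"
    and "compact_operator S"
    and "singular_system S I \<sigma> e"
    and "n \<ge> 1" and "k \<ge> 1"
    and "\<forall>i\<in>I \<inter> {1..n + k}. et i \<in> cls (e i)"
  shows "e_std_wor n S e et (I \<inter> {1..n + k}) \<ge> e_all_wor n S"
proof -
  have S: "bounded_linear S" by (rule compact_operator_bounded_linear) fact
  have "e_all_wor n S \<le> ennreal (\<sigma> (Suc n))"
    by (rule e_all_wor_le[OF S assms(3)])
  also have "\<dots> \<le> e_std_wor n S e et (I \<inter> {1..n + k})"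
    by (rule e_std_wor_ge[OF S assms(3,5)])
  finally show ?thesis .
qed

end
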